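(* Let $D,Q\in\mathbb N$ with $(D,Q)=1$ and $D/Q>1$, and suppose $D/Q$ is not the square of a rational number. Let $m\ge 0$ be the smallest integer such that $\sqrt{D/Q}$ has the periodic continued fraction expansion $\sqrt{D/Q}=[b_0,\{b_1,\ldots,b_m,2b_0\}]$ with $b_0,\ldots,b_m\in\mathbb N$, and let $r_k/s_k$, $k=0,1,2,\ldots$, be the $k$th convergent of $\sqrt{D/Q}$. Let $r_k+s_k\sqrt{D/Q}$ be a regular unit, i.e., $k=l(m+1)-1$ for some $l\in\mathbb N$. Let $t\in\mathbb N$ be a divisor of $s_k$, and let $$r_k/t=[c_0,\ldots,c_n]$$ be the (finite) continued fraction expansion of the rational number $r_k/t$ with $n\equiv k \bmod 2$. Then $$(s_k/t)\sqrt{D/Q}=[c_0,\{c_1,\ldots,c_n,2c_0\}].$$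
   Context: $\mathbb N=\{1,2,3,\ldots\}$ and $(a,b)$ denotes the greatest common divisor. The notation $[b_0,\{b_1,\ldots,b_m,2b_0\}]$ denotes the infinite simple continued fraction with initial term $b_0$ followed by the block $b_1,\ldots,b_m,2b_0$ (of length $m+1$) repeated periodically forever; for $D/Q>1$ as in the claim, $\sqrt{D/Q}$ always has an expansion of this form. Convergents $r_k/s_k=[b_0,b_1,\ldots,b_k]$ are indexed from $k=0$ and written in lowest terms with $r_k,s_k\in\mathbb N$, $(r_k,s_k)=1$. Regular units: let $q$ be the smallest positive divisor of $Q$ such that $Q\mid q^2$, let $D_1=Dq^2/Q\in\mathbb N$ and $D_2=DQ=D_1(Q/q)^2$, so that $\mathbb Z[\sqrt{D_2}]\subseteq\mathbb Z[\sqrt{D_1}]$. A unit of $\mathbb Z[\sqrt{D_1}]$ is called regular if it lies in $\mathbb Z[\sqrt{D_2}]$. The number $r_k+s_k\sqrt{D/Q}$ is a regular unit if and only if $k=l(m+1)-1$ for some $l\in\mathbb N$. Finite continued fractions $[c_0,\ldots,c_n]$ of rational numbers are simple ($c_0\in\mathbb Z$, $c_i\in\mathbb N$ for $i\ge1$), and the last term $c_n$ is not required to be $\ge 2$; thus the parity of $n$ can be prescribed, by replacing a last term $c_n\geq 2$ by the two terms $c_n-1,1$ if necessary. *)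

theory Defs
  imports Complex_Main
begin

fun cf_value :: "int list \<Rightarrow> real" where
  "cf_value [] = 0"
| "cf_value [a] = of_int a"
| "cf_value (a # b # as) = of_int a + 1 / cf_value (b # as)"

text \<open>
  Simple continued fractions: the leading term is an arbitrary integer, all later terms are
  positive. A finite expansion may end in 1.
\<close>

definition fin_cf_expansion :: "real \<Rightarrow> (nat \<Rightarrow> int) \<Rightarrow> nat \<Rightarrow> bool" where
  "fin_cf_expansion x a n \<longleftrightarrow> (\<forall>i\<in>{1..n}. 1 \<le> a i) \<and> x = cf_value (map a [0..<Suc n])"

definition cf_expansion :: "real \<Rightarrow> (nat \<Rightarrow> int) \<Rightarrow> bool" where
  "cf_expansion x a \<longleftrightarrow>
     (\<forall>i\<ge>1. 1 \<le> a i) \<and> (\<lambda>n. cf_value (map a [0..<Suc n])) \<longlonglongrightarrow> x"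

text \<open>
  The sequence of terms of \<open>[a\<^sub>0, {a\<^sub>1, \<dots>, a\<^sub>m, 2 a\<^sub>0}]\<close>. Only the values of \<open>a\<close> at \<open>0, \<dots>, m\<close> matter.
\<close>

definition periodic_terms :: "(nat \<Rightarrow> int) \<Rightarrow> nat \<Rightarrow> nat \<Rightarrow> int" where
  "periodic_terms a m i =
     (case i of 0 \<Rightarrow> a 0 | Suc j \<Rightarrow> (map a [1..<Suc m] @ [2 * a 0]) ! (j mod Suc m))"

definition sqrt_type_expansion :: "real \<Rightarrow> (nat \<Rightarrow> int) \<Rightarrow> nat \<Rightarrow> bool" where
  "sqrt_type_expansion x b m \<longleftrightarrow> (\<forall>i\<le>m. 1 \<le> b i) \<and> cf_expansion x (periodic_terms b m)"

definition int_adjoin_sqrt :: "nat \<Rightarrow> real set" where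
  "int_adjoin_sqrt d = {of_int x + of_int y * sqrt (real d) | x y. True}"

definition unit_of :: "real set \<Rightarrow> real \<Rightarrow> bool" where
  "unit_of R u \<longleftrightarrow> u \<in> R \<and> (\<exists>v\<in>R. u * v = 1)"

text \<open>
  With \<open>q\<close> the least positive divisor of \<open>Q\<close> such that \<open>Q\<close> divides \<open>q\<^sup>2\<close>, the regular units are the
  units of \<open>\<int>[\<surd>D\<^sub>1]\<close>, \<open>D\<^sub>1 = D q\<^sup>2 / Q\<close>, lying in \<open>\<int>[\<surd>D\<^sub>2]\<close>, \<open>D\<^sub>2 = D Q\<close>. The division is exact.
\<close>

definition regular_unit :: "nat \<Rightarrow> nat \<Rightarrow> real \<Rightarrow> bool" where
  "regular_unit D Q u \<longleftrightarrow>
     (let q = (LEAST q. 0 < q \<and> q dvd Q \<and> Q dvd q ^ 2);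
          D1 = D * q ^ 2 div Q;
          D2 = D * Q
      in unit_of (int_adjoin_sqrt D1) u \<and> u \<in> int_adjoin_sqrt D2)"

end

theory Submission
  imports Defs
begin

text \<open>
  Put \<open>r = r\<^sub>k\<close>, \<open>s = s\<^sub>k\<close>. Both descriptions of a regular unit amount to \<open>Q\<close> dividing \<open>s\<close> and
  \<open>r\<^sup>2 - s\<^sup>2 D/Q = (-1)\<^sup>k\<^sup>+\<^sup>1\<close>; hence \<open>s\<^sup>2 D/Q = s N\<close> with an integer \<open>N > s\<close>. For \<open>r/t = [c\<^sub>0, \<dots>, c\<^sub>n]\<close>
  with last two denominators \<open>q\<^sub>n = t\<close>, \<open>q\<^sub>n\<^sub>-\<^sub>1\<close>, this norm equation forces \<open>q\<^sub>n\<^sub>-\<^sub>1 = r - c\<^sub>0 t\<close>, which says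
  precisely that \<open>x = \<surd>(s N)/t\<close> satisfies \<open>x = [c\<^sub>0, \<dots>, c\<^sub>n, c\<^sub>0 + x]\<close>.
\<close>

section \<open>Finite continued fractions with a real last term\<close>

text \<open>\<open>cf_ext [a\<^sub>0, \<dots>, a\<^sub>k] x\<close> is \<open>[a\<^sub>0, \<dots>, a\<^sub>k, x]\<close> with a real last term \<open>x\<close>.\<close>

definition cf_ext :: "int list \<Rightarrow> real \<Rightarrow> real" where
  "cf_ext as x = foldr (\<lambda>a y. of_int a + 1 / y) as x"

lemma cf_ext_Nil [simp]: "cf_ext [] x = x"
  and cf_ext_Cons [simp]: "cf_ext (a # as) x = of_int a + 1 / cf_ext as x"
  and cf_ext_append: "cf_ext (as @ as') x = cf_ext as (cf_ext as' x)"
  by (simp_all add: cf_ext_def)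

lemma cf_value_snoc: "cf_value (as @ [a]) = cf_ext as (of_int a)"
  by (induction as rule: cf_value.induct) auto

lemma cf_value_append: "as' \<noteq> [] \<Longrightarrow> cf_value (as @ as') = cf_ext as (cf_value as')"
  by (metis append_assoc append_butlast_last_id cf_ext_append cf_value_snoc)

section \<open>Numerators and denominators of convergents\<close>

text \<open>Indices are shifted by one: the \<open>k\<close>-th convergent is \<open>cf_num a (k + 1) / cf_den a (k + 1)\<close>.\<close>

fun cf_num :: "(nat \<Rightarrow> int) \<Rightarrow> nat \<Rightarrow> int" where
  "cf_num a 0 = 1"
| "cf_num a (Suc 0) = a 0"
| "cf_num a (Suc (Suc k)) = a (Suc k) * cf_num a (Suc k) + cf_num a k"

fun cf_den :: "(nat \<Rightarrow> int) \<Rightarrow> nat \<Rightarrow> int" where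
  "cf_den a 0 = 0"
| "cf_den a (Suc 0) = 1"
| "cf_den a (Suc (Suc k)) = a (Suc k) * cf_den a (Suc k) + cf_den a k"

lemma cf_det: "cf_num a (Suc k) * cf_den a k - cf_num a k * cf_den a (Suc k) = (-1) ^ Suc k"
proof (induction k)
  case (Suc k)
  have "cf_num a (Suc (Suc k)) * cf_den a (Suc k) - cf_num a (Suc k) * cf_den a (Suc (Suc k))
      = - (cf_num a (Suc k) * cf_den a k - cf_num a k * cf_den a (Suc k))"
    by (simp add: algebra_simps)
  then show ?case using Suc by simp
qed simp

lemma cf_num_den_coprime: "coprime (cf_num a (Suc k)) (cf_den a (Suc k))"
proof (rule coprimeI)
  fix d assume "d dvd cf_num a (Suc k)" "d dvd cf_den a (Suc k)"
  then have "d dvd (-1) ^ Suc k"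
    unfolding cf_det [of a k, symmetric] by simp
  then show "is_unit d"
    by (rule dvd_unit_imp_unit) (simp add: is_unit_power_iff)
qed

text \<open>The three bounds feed one another in the induction, since the recurrence reaches back
  two steps.\<close>

lemma cf_den_bounds:
  assumes "\<forall>i\<in>{1..k}. 1 \<le> a i"
  shows "0 \<le> cf_den a k \<and> cf_den a k \<le> cf_den a (Suc k) \<and> 1 \<le> cf_den a (Suc k)"
  using assms
proof (induction k)
  case (Suc k)
  then have "0 \<le> cf_den a k" "1 \<le> cf_den a (Suc k)" "1 \<le> a (Suc k)"
    by auto
  moreover from this have "1 * cf_den a (Suc k) \<le> a (Suc k) * cf_den a (Suc k)"
    by (intro mult_right_mono) auto
  ultimately show ?case unfolding cf_den.simps by linarith
qed simp

text \<open>Linear growth is enough for convergence. Each step adds at least the previous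
  denominator; only at the first step is that \<open>cf_den a 0 = 0\<close>, and there
  \<open>1 \<le> a 1\<close> suffices.\<close>

lemma cf_den_ge:
  assumes "\<forall>i\<in>{1..k}. 1 \<le> a i"
  shows "int k \<le> cf_den a (Suc k)"
  using assms
proof (induction k)
  case (Suc k)
  show ?case
  proof (cases k)
    case 0
    then show ?thesis using Suc.prems by simp
  next
    case (Suc j)
    have "1 \<le> cf_den a k"
      using cf_den_bounds [of j a] Suc.prems Suc by auto
    moreover have "1 * cf_den a (Suc k) \<le> a (Suc k) * cf_den a (Suc k)"
      using Suc.prems cf_den_bounds [of k a] by (intro mult_right_mono) auto
    ultimately show ?thesis using Suc.IH Suc.prems by simp
  qed
qed simp

lemma cf_ext_den_pos:
  assumes "\<forall>i\<in>{1..k}. 1 \<le> a i" and "0 < x"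
  shows "0 < real_of_int (cf_den a (Suc k)) * x + of_int (cf_den a k)"
  using cf_den_bounds [OF assms(1)] assms(2) by (intro add_pos_nonneg) auto

text \<open>The terms act on \<open>x\<close> as a product of Moebius transformations. In the
  induction the last term is absorbed into the real argument as \<open>y\<close>, and the fraction
  is then expanded by \<open>x\<close>.\<close>

lemma cf_ext_conv:
  assumes "\<forall>i\<in>{1..k}. 1 \<le> a i" and "0 < x"
  shows "cf_ext (map a [0..<Suc k]) x =
    (of_int (cf_num a (Suc k)) * x + of_int (cf_num a k)) /
    (of_int (cf_den a (Suc k)) * x + of_int (cf_den a k))"
  using assms
proof (induction k arbitrary: x)
  case 0
  then show ?case by (simp add: field_simps)
next
  case (Suc k)
  define y where "y = of_int (a (Suc k)) + 1 / x"
  have "1 \<le> a (Suc k)" using Suc.prems by auto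
  then have "0 < real_of_int (a (Suc k))" by simp
  then have y: "0 < y" using Suc.prems(2) by (simp add: y_def add_pos_pos)
  have yx: "y * x = of_int (a (Suc k)) * x + 1"
    using Suc.prems(2) by (simp add: y_def field_simps)
  have "cf_ext (map a [0..<Suc (Suc k)]) x = cf_ext (map a [0..<Suc k]) y"
    by (simp add: cf_ext_append y_def)
  also have "\<dots> = (of_int (cf_num a (Suc k)) * y + of_int (cf_num a k)) /
    (of_int (cf_den a (Suc k)) * y + of_int (cf_den a k))"
    using Suc.prems y by (intro Suc.IH) auto
  also have "\<dots> = ((of_int (cf_num a (Suc k)) * y + of_int (cf_num a k)) * x) /
    ((of_int (cf_den a (Suc k)) * y + of_int (cf_den a k)) * x)"
    using Suc.prems(2) by simp
  also have "\<dots> = (of_int (cf_num a (Suc k)) * (y * x) + of_int (cf_num a k) * x) /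
    (of_int (cf_den a (Suc k)) * (y * x) + of_int (cf_den a k) * x)"
    by (simp add: algebra_simps)
  finally show ?case unfolding yx by (simp add: algebra_simps)
qed

lemma cf_value_conv:
  assumes "\<forall>i\<in>{1..k}. 1 \<le> a i"
  shows "cf_value (map a [0..<Suc k]) = of_int (cf_num a (Suc k)) / of_int (cf_den a (Suc k))"
proof (cases k)
  case (Suc j)
  have "1 \<le> a (Suc j)" using assms by (auto simp: Suc)
  then have pos: "0 < real_of_int (a (Suc j))" by simp
  have "cf_value (map a [0..<Suc k]) = cf_ext (map a [0..<Suc j]) (of_int (a (Suc j)))"
    using cf_value_snoc [of "map a [0..<Suc j]"] by (simp add: Suc)
  also have "\<dots> = of_int (cf_num a (Suc k)) / of_int (cf_den a (Suc k))"
    using assms pos by (subst cf_ext_conv) (auto simp: Suc algebra_simps)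
  finally show ?thesis .
qed simp

text \<open>The numerator of the difference is the determinant of two consecutive convergents. The
  formula yields both the speed of convergence and the side on which a convergent lies.\<close>

lemma cf_ext_diff:
  assumes "\<forall>i\<in>{1..k}. 1 \<le> a i" and "0 < x"
  shows "cf_ext (map a [0..<Suc k]) x - cf_value (map a [0..<Suc k]) =
    (-1) ^ k / (of_int (cf_den a (Suc k)) *
      (of_int (cf_den a (Suc k)) * x + of_int (cf_den a k)))"
proof -
  define p q p' q' :: real where
    "p = of_int (cf_num a (Suc k))" and "q = of_int (cf_den a (Suc k))" and
    "p' = of_int (cf_num a k)" and "q' = of_int (cf_den a k)"
  have q: "0 < q" using cf_den_bounds [OF assms(1)] by (simp add: q_def)
  have d: "0 < q * x + q'" using cf_ext_den_pos [OF assms] by (simp add: q_def q'_def)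
  have "p * q' - p' * q = of_int ((-1) ^ Suc k)"
    unfolding cf_det [of a k, symmetric] by (simp add: p_def q_def p'_def q'_def)
  then have det: "p' * q - p * q' = (-1) ^ k" by simp
  have "(p * x + p') / (q * x + q') - p / q = (p' * q - p * q') / (q * (q * x + q'))"
    using q d by (simp add: field_simps)
  then show ?thesis
    using cf_ext_conv [OF assms] cf_value_conv [OF assms(1)] det
    by (simp add: p_def q_def p'_def q'_def)
qed

section \<open>Infinite expansions from complete quotients\<close>

text \<open>The \<open>X i\<close> are the complete quotients: \<open>X 0\<close> is
  \<open>[a 0, ..., a i, X (Suc i)]\<close> for every \<open>i\<close>, so the error formula bounds
  its distance from the \<open>i\<close>-th convergent.\<close>

lemma cf_expansionI:
  fixes X :: "nat \<Rightarrow> real"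
  assumes a: "\<And>i. 1 \<le> i \<Longrightarrow> 1 \<le> a i"
    and X: "\<And>i. X i = of_int (a i) + 1 / X (Suc i)"
    and pos: "\<And>i. 0 < X (Suc i)"
  shows "cf_expansion (X 0) a"
proof -
  have X_ge: "1 \<le> X (Suc i)" for i
  proof -
    have "1 \<le> real_of_int (a (Suc i))" using a [of "Suc i"] by simp
    moreover have "0 < 1 / X (Suc (Suc i))" using pos by simp
    ultimately show ?thesis using X [of "Suc i"] by linarith
  qed
  have ext: "cf_ext (map a [0..<i]) (X i) = X 0" for i
  proof (induction i)
    case (Suc i)
    then show ?case by (simp add: cf_ext_append flip: X)
  qed simp
  have bound: "norm (cf_value (map a [0..<Suc i]) - X 0) \<le> 1 / real i" if "0 < i" for i
  proof -
    have ai: "\<forall>j\<in>{1..i}. 1 \<le> a j" using a by auto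
    define q q' :: real where
      "q = of_int (cf_den a (Suc i))" and "q' = of_int (cf_den a i)"
    have q: "1 \<le> q" "0 \<le> q'"
      using cf_den_bounds [OF ai] by (auto simp: q_def q'_def)
    have qi: "real i \<le> q"
      using cf_den_ge [OF ai] unfolding q_def by linarith
    \<comment> \<open>The second factor of the error denominator is at least 1, so the growth of
      \<open>q\<close> alone makes the error at most \<open>1 / i\<close>.\<close>
    have "1 * 1 \<le> q * X (Suc i)" using q X_ge by (intro mult_mono) auto
    then have d: "1 \<le> q * X (Suc i) + q'" using q by simp
    then have "q * 1 \<le> q * (q * X (Suc i) + q')" using q by (intro mult_left_mono) auto
    then have qd: "real i \<le> q * (q * X (Suc i) + q')" using qi by simp
    have "X 0 - cf_value (map a [0..<Suc i]) = (-1) ^ i / (q * (q * X (Suc i) + q'))"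
      using cf_ext_diff [OF ai pos [of i]] unfolding ext q_def q'_def .
    then have "norm (X 0 - cf_value (map a [0..<Suc i])) = 1 / (q * (q * X (Suc i) + q'))"
      using q d by (simp add: abs_mult del: upt_Suc)
    then have "norm (cf_value (map a [0..<Suc i]) - X 0) = 1 / (q * (q * X (Suc i) + q'))"
      by (simp only: norm_minus_commute)
    also have "\<dots> \<le> 1 / real i" using qd q d that by (intro divide_left_mono mult_pos_pos) linarith+
    finally show ?thesis .
  qed
  have "(\<lambda>i. cf_value (map a [0..<Suc i]) - X 0) \<longlonglongrightarrow> 0"
    by (rule tendsto_0_le [OF lim_1_over_n, where K = 1])
       (use bound in \<open>auto simp: eventually_sequentially norm_divide simp del: upt_Suc intro!: exI [of _ 1]\<close>)
  then have "(\<lambda>i. cf_value (map a [0..<Suc i])) \<longlonglongrightarrow> X 0"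
    by (rule LIM_zero_cancel)
  then show ?thesis
    using a by (simp add: cf_expansion_def)
qed

section \<open>Periodic expansions from a fixed-point equation\<close>

lemma cf_ext_pos:
  assumes "\<forall>a\<in>set as. 1 \<le> a" and "0 < x"
  shows "0 < cf_ext as x"
  using assms
proof (induction as)
  case (Cons a as)
  then have "1 \<le> a" "0 < cf_ext as x" by auto
  then show ?case by (simp add: add_pos_pos)
qed simp

lemma periodic_terms_0 [simp]: "periodic_terms a m 0 = a 0"
  by (simp add: periodic_terms_def)

lemma periodic_terms_Suc:
  "periodic_terms a m (Suc j) = (if j mod Suc m < m then a (Suc (j mod Suc m)) else 2 * a 0)"
proof -
  have "j mod Suc m \<le> m" using mod_less_divisor [of "Suc m" j] by simp
  then show ?thesis
    by (auto simp: periodic_terms_def nth_append simp del: upt_Suc)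
qed

text \<open>Index 0 lies outside the period: it carries \<open>a 0\<close>, whereas the positive
  multiples of \<open>Suc m\<close> carry \<open>2 * a 0\<close>. Hence the condition
  \<open>1 \<le> i\<close>.\<close>

lemma periodic_terms_shift:
  assumes "1 \<le> i"
  shows "periodic_terms a m (l * Suc m + i) = periodic_terms a m i"
proof -
  obtain j where i: "i = Suc j" using assms by (cases i) auto
  show ?thesis unfolding i add_Suc_right periodic_terms_Suc mod_mult_self3 ..
qed

lemma periodic_terms_end:
  assumes "1 \<le> l"
  shows "periodic_terms a m (l * Suc m) = 2 * a 0"
proof -
  obtain l' where l: "l = Suc l'" using assms by (cases l) auto
  have "l * Suc m = Suc (m + l' * Suc m)" by (simp add: l)
  moreover have "(m + l' * Suc m) mod Suc m = m" by (metis mod_mult_self1 mod_less lessI)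
  ultimately show ?thesis by (simp only: periodic_terms_Suc) simp
qed

lemma periodic_terms_ge_1:
  assumes "1 \<le> a 0" and "\<And>i. 1 \<le> i \<Longrightarrow> i \<le> m \<Longrightarrow> 1 \<le> a i"
  shows "1 \<le> periodic_terms a m i"
  using assms by (cases i) (auto simp: periodic_terms_Suc)

text \<open>If \<open>x = [c 0, ..., c n, c 0 + x]\<close>, then the last entry
  \<open>c 0 + x\<close> is again an expansion of the same shape with first term
  \<open>2 * c 0\<close>, so the complete quotients repeat.\<close>

lemma cf_expansion_periodicI:
  assumes c: "1 \<le> c 0" "\<And>i. 1 \<le> i \<Longrightarrow> i \<le> n \<Longrightarrow> 1 \<le> c i"
    and x: "0 < x" "cf_ext (map c [0..<Suc n]) (of_int (c 0) + x) = x"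
  shows "cf_expansion x (periodic_terms c n)"
proof -
  define Y where "Y e = cf_ext (map c [e..<Suc n]) (of_int (c 0) + x)" for e
  \<comment> \<open>After \<open>X 0 = x\<close> the quotients cycle through
    \<open>Y 1, ..., Y (Suc n)\<close>. The block closes because
    \<open>Y (Suc n) = c 0 + x = 2 * c 0 + 1 / Y 1\<close>.\<close>
  define X where "X i = (case i of 0 \<Rightarrow> x | Suc j \<Rightarrow> Y (Suc (j mod Suc n)))" for i
  have Y_rec: "Y e = of_int (c e) + 1 / Y (Suc e)" if "e \<le> n" for e
    using that upt_conv_Cons [of e "Suc n"] by (simp add: Y_def del: upt_Suc)
  have Y_end: "Y (Suc n) = of_int (c 0) + x" by (simp add: Y_def)
  have Y0: "Y 0 = x" using x(2) by (simp add: Y_def)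
  have Y_pos: "0 < Y (Suc e)" for e
    unfolding Y_def using c x(1) by (intro cf_ext_pos) (auto simp del: upt_Suc intro!: add_pos_pos)
  have X_rec: "X i = of_int (periodic_terms c n i) + 1 / X (Suc i)" for i
  proof (cases i)
    case 0
    then show ?thesis using Y_rec [of 0] Y0 by (simp add: X_def)
  next
    case (Suc j)
    show ?thesis
    proof (cases "j mod Suc n < n")
      case True
      then have "Suc j mod Suc n = Suc (j mod Suc n)" by (simp add: mod_Suc)
      then show ?thesis
        using True Y_rec [of "Suc (j mod Suc n)"] by (simp add: Suc X_def periodic_terms_Suc)
    next
      case False
      then have j: "j mod Suc n = n" using mod_less_divisor [of "Suc n" j] by linarith
      then have "Suc j mod Suc n = 0" by (simp add: mod_Suc)
      then show ?thesis
        using j Y_rec [of 0] Y0 Y_end by (simp add: Suc X_def periodic_terms_Suc)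
    qed
  qed
  have "cf_expansion (X 0) (periodic_terms c n)"
  proof (rule cf_expansionI)
    show "1 \<le> periodic_terms c n i" for i using c by (rule periodic_terms_ge_1)
    show "0 < X (Suc i)" for i using Y_pos by (simp add: X_def)
  qed (rule X_rec)
  then show ?thesis by (simp add: X_def)
qed


section \<open>Consequences of a given infinite expansion\<close>

lemma cf_value_pos:
  assumes "as \<noteq> []" "\<forall>a\<in>set as. 1 \<le> a"
  shows "0 < cf_value as"
proof -
  obtain as' a where as: "as = as' @ [a]" using assms(1) by (metis append_butlast_last_id)
  then have "1 \<le> a" using assms(2) by simp
  then have "0 < real_of_int a" by simp
  then show ?thesis using assms(2) unfolding as cf_value_snoc by (intro cf_ext_pos) auto
qed

lemma map_upt_split:
  "map a [0..<Suc (k + Suc i)] = map a [0..<Suc k] @ map a [Suc k..<Suc (k + Suc i)]"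
  by (metis add_Suc map_append plus_nat.add_0 upt_add_eq_append zero_le)

text \<open>Every later convergent is the \<open>k\<close>-th one with a positive real term
  appended, so \<open>cf_ext_diff\<close> fixes the sign of the difference; the weak inequality
  passes to the limit.\<close>

lemma cf_expansion_sign:
  assumes "cf_expansion x a"
  shows "0 \<le> (-1) ^ k * (x - cf_value (map a [0..<Suc k]))"
proof -
  have a: "\<forall>i\<ge>1. 1 \<le> a i" and lim: "(\<lambda>i. cf_value (map a [0..<Suc i])) \<longlonglongrightarrow> x"
    using assms by (auto simp: cf_expansion_def)
  have "0 \<le> (-1) ^ k * (cf_value (map a [0..<Suc (k + Suc i)]) - cf_value (map a [0..<Suc k]))" for i
  proof -
    define y where "y = cf_value (map a [Suc k..<Suc (k + Suc i)])"
    have y: "0 < y" unfolding y_def using a by (intro cf_value_pos) (auto simp del: upt_Suc)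
    have ai: "\<forall>j\<in>{1..k}. 1 \<le> a j" using a by auto
    have "cf_value (map a [0..<Suc (k + Suc i)]) = cf_ext (map a [0..<Suc k]) y"
      unfolding map_upt_split y_def by (rule cf_value_append) simp
    then have "(-1) ^ k * (cf_value (map a [0..<Suc (k + Suc i)]) - cf_value (map a [0..<Suc k]))
      = ((-1) ^ k * (-1) ^ k) / (of_int (cf_den a (Suc k)) *
      (of_int (cf_den a (Suc k)) * y + of_int (cf_den a k)))"
      using cf_ext_diff [OF ai y] by simp
    also have "\<dots> \<ge> 0"
      using cf_den_bounds [OF ai] cf_ext_den_pos [OF ai y] by (simp flip: power_mult_distrib)
    finally show ?thesis .
  qed
  then have "\<forall>i. 0 \<le> (-1) ^ k * (cf_value (map a [0..<Suc (k + Suc i)])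
      - cf_value (map a [0..<Suc k]))" by blast
  moreover have "(\<lambda>i. (-1) ^ k * (cf_value (map a [0..<Suc (k + Suc i)])
      - cf_value (map a [0..<Suc k]))) \<longlonglongrightarrow> (-1) ^ k * (x - cf_value (map a [0..<Suc k]))"
    using LIMSEQ_ignore_initial_segment [OF lim, of "Suc k"]
    by (intro tendsto_intros) (simp add: add.commute)
  ultimately show ?thesis by (intro tendsto_lowerbound [OF _ always_eventually sequentially_bot])
qed

text \<open>Converse of \<open>cf_expansion_periodicI\<close>, over \<open>l\<close> periods at
  once: convergents beyond index \<open>k\<close> are Moebius images of \<open>b 0\<close> plus
  earlier convergents, and both sides have limits.\<close>

lemma sqrt_type_expansion_fixpoint:
  assumes b: "sqrt_type_expansion x b m" and x: "0 < x" and l: "1 \<le> l" and k: "Suc k = l * Suc m"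
  shows "cf_ext (map (periodic_terms b m) [0..<Suc k]) (of_int (b 0) + x) = x"
proof -
  define a where "a = periodic_terms b m"
  have lim: "(\<lambda>i. cf_value (map a [0..<Suc i])) \<longlonglongrightarrow> x"
    and b1: "\<forall>i\<le>m. 1 \<le> b i" and a1: "\<forall>i\<ge>1. 1 \<le> a i"
    using b by (auto simp: sqrt_type_expansion_def cf_expansion_def a_def)
  have b0: "1 \<le> b 0" using b1 by simp
  have ai: "\<forall>j\<in>{1..k}. 1 \<le> a j" using a1 by auto
  have a0: "a 0 = b 0" by (simp add: a_def)
  have a_end: "a (Suc k) = 2 * b 0"
    using periodic_terms_end [OF l] by (simp add: k a_def)
  have a_shift: "a (Suc k + i) = a i" if "1 \<le> i" for i
    using periodic_terms_shift [OF that] by (simp only: k a_def)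
  have pos_all: "1 \<le> a i" for i
    using a0 b0 a1 by (cases i) auto
  \<comment> \<open>\<open>y i\<close> is the value of the \<open>Suc i\<close> terms that follow
    index \<open>k\<close>. These start with \<open>2 * b 0\<close> and then repeat
    \<open>a 1, ..., a i\<close>, which gives \<open>b 0\<close> plus the \<open>i\<close>-th
    convergent.\<close>
  define y where "y i = of_int (b 0) + cf_value (map a [0..<Suc i])" for i
  have y: "0 < y i" for i
    unfolding y_def using b0 pos_all by (intro add_pos_pos cf_value_pos) auto
  have tail: "cf_value (map a [Suc k..<Suc (k + Suc i)]) = y i" for i
  proof -
    have "map a [Suc k..<Suc (k + Suc i)] = map (\<lambda>j. a (j + Suc k)) [0..<Suc i]"
      by (rule nth_equalityI) (simp_all add: add.commute del: upt_Suc)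
    also have "\<dots> = 2 * b 0 # map a [1..<Suc i]"
      using a_end a_shift upt_conv_Cons [of 0 "Suc i"] by (simp add: add.commute del: upt_Suc)
    finally have 1: "map a [Suc k..<Suc (k + Suc i)] = 2 * b 0 # map a [1..<Suc i]" .
    have 2: "map a [0..<Suc i] = b 0 # map a [1..<Suc i]"
      using a0 upt_conv_Cons [of 0 "Suc i"] by (simp del: upt_Suc)
    show ?thesis unfolding 1 y_def 2 by (cases "map a [1..<Suc i]") simp_all
  qed
  have conv: "cf_value (map a [0..<Suc (k + Suc i)]) =
    (of_int (cf_num a (Suc k)) * y i + of_int (cf_num a k)) /
    (of_int (cf_den a (Suc k)) * y i + of_int (cf_den a k))" for i
    unfolding map_upt_split cf_ext_conv [OF ai y, symmetric]
    by (subst cf_value_append) (simp_all only: tail, simp)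
  have x': "0 < of_int (b 0) + x" using b0 x by (intro add_pos_pos) auto
  have ylim: "y \<longlonglongrightarrow> of_int (b 0) + x"
    unfolding y_def by (intro tendsto_intros lim)
  have "(\<lambda>i. cf_value (map a [0..<Suc (k + Suc i)])) \<longlonglongrightarrow>
    (of_int (cf_num a (Suc k)) * (of_int (b 0) + x) + of_int (cf_num a k)) /
    (of_int (cf_den a (Suc k)) * (of_int (b 0) + x) + of_int (cf_den a k))"
    unfolding conv using cf_ext_den_pos [OF ai x'] by (intro tendsto_intros ylim) simp
  moreover have "(\<lambda>i. cf_value (map a [0..<Suc (k + Suc i)])) \<longlonglongrightarrow> x"
    using LIMSEQ_ignore_initial_segment [OF lim, of "Suc k"] by (simp add: add.commute)
  ultimately have "x = (of_int (cf_num a (Suc k)) * (of_int (b 0) + x) + of_int (cf_num a k)) /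
    (of_int (cf_den a (Suc k)) * (of_int (b 0) + x) + of_int (cf_den a k))"
    using LIMSEQ_unique by blast
  then show ?thesis using cf_ext_conv [OF ai x'] by (simp add: a_def)
qed

section \<open>Uniqueness of coefficients and of reduced fractions\<close>

lemma irrational_coeffs_eq:
  fixes x :: real
  assumes "x \<notin> \<rat>" and "a + b * x = c + d * x" and "a \<in> \<rat>" "b \<in> \<rat>" "c \<in> \<rat>" "d \<in> \<rat>"
  shows "a = c \<and> b = d"
proof -
  have "b = d"
  proof (rule ccontr)
    assume "b \<noteq> d"
    then have "x = (c - a) / (b - d)" using assms(2) by (simp add: field_simps)
    then show False using assms by (metis Rats_diff Rats_divide)
  qed
  then show ?thesis using assms(2) by simp
qed

lemma reduced_fraction_unique:
  fixes r t :: nat and p q :: int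
  assumes "real r / real t = of_int p / of_int q" and "0 < t" "0 < q"
    and "coprime r t" and "coprime p q"
  shows "p = int r \<and> q = int t"
proof -
  have "real r * of_int q = of_int p * real t"
    using assms(1-3) by (simp add: field_simps)
  then have "of_int (int r * q) = (of_int (p * int t) :: real)" by simp
  then have eq: "int r * q = p * int t" by (simp only: of_int_eq_iff)
  have "int r dvd p"
    using assms(4) by (metis eq coprime_dvd_mult_left_iff coprime_int_iff dvd_triv_left)
  moreover have "p dvd int r"
    using assms(5) by (metis eq coprime_dvd_mult_left_iff dvd_triv_left)
  moreover have "0 \<le> p"
    using eq assms(2,3) by (metis mult_nonneg_nonneg of_nat_0_le_iff of_nat_0_less_iff less_imp_le zero_le_mult_iff not_le)
  ultimately have "p = int r" using zdvd_antisym_nonneg [of p "int r"] by simp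
  moreover have "q = int t"
  \<comment> \<open>For \<open>r = 0\<close> nothing can be cancelled, but coprimality makes both
    denominators 1.\<close>
  proof (cases "r = 0")
    case True
    then show ?thesis using assms(2-5) \<open>p = int r\<close> by simp
  next
    case False
    then show ?thesis using eq \<open>p = int r\<close> by simp
  qed
  ultimately show ?thesis by simp
qed

section \<open>From the norm equation to the expansion\<close>

text \<open>\<open>R\<close> satisfies the recurrence of the denominators, and
  \<open>R i / cf_den a i\<close> is the convergent with its first term replaced by 0, which lies
  between 0 and 1.\<close>

lemma cf_num_remainder:
  assumes "\<forall>i\<in>{1..Suc k}. 1 \<le> a i"
  defines "R \<equiv> \<lambda>i. cf_num a i - a 0 * cf_den a i"
  shows "0 \<le> R (Suc k) \<and> R (Suc k) \<le> cf_den a (Suc k) \<and>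
    1 \<le> R (Suc (Suc k)) \<and> R (Suc (Suc k)) \<le> cf_den a (Suc (Suc k))"
  using assms(1)
proof (induction k)
  case 0
  then show ?case by (simp add: R_def algebra_simps)
next
  case (Suc k)
  have IH: "0 \<le> R (Suc k)" "R (Suc k) \<le> cf_den a (Suc k)"
    "1 \<le> R (Suc (Suc k))" "R (Suc (Suc k)) \<le> cf_den a (Suc (Suc k))"
    using Suc.IH Suc.prems by auto
  have c: "1 \<le> a (Suc (Suc k))" using Suc.prems by auto
  have R: "R (Suc (Suc (Suc k))) = a (Suc (Suc k)) * R (Suc (Suc k)) + R (Suc k)"
    by (simp add: R_def algebra_simps)
  have "1 * 1 \<le> a (Suc (Suc k)) * R (Suc (Suc k))" using c IH by (intro mult_mono) auto
  moreover have "a (Suc (Suc k)) * R (Suc (Suc k)) \<le> a (Suc (Suc k)) * cf_den a (Suc (Suc k))"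
    using c IH by (intro mult_left_mono) auto
  ultimately show ?case using IH unfolding R cf_den.simps(3) [of a "Suc k"] by linarith
qed

text \<open>
  Comparing the determinant \<open>p\<^sub>n q\<^sub>n\<^sub>-\<^sub>1 - p\<^sub>n\<^sub>-\<^sub>1 q\<^sub>n\<close> with the norm \<open>r\<^sup>2 - s N\<close> modulo \<open>t = q\<^sub>n\<close> gives
  \<open>q\<^sub>n\<^sub>-\<^sub>1 \<equiv> r\<close>, hence \<open>q\<^sub>n\<^sub>-\<^sub>1 = r - c\<^sub>0 t\<close> because both sides lie between \<open>1\<close> and \<open>t\<close> when \<open>n \<ge> 1\<close>.
\<close>

lemma cf_expansion_of_norm:
  fixes r s t N n :: nat
  assumes norm: "(int r)\<^sup>2 - int s * int N = (-1) ^ Suc n" and N: "s < N" and s: "0 < s"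
    and t: "0 < t" "t dvd s" and c: "fin_cf_expansion (real r / real t) c n"
  shows "cf_expansion (sqrt (real s * real N) / real t) (periodic_terms c n)"
proof -
  have c1: "\<forall>i\<in>{1..n}. 1 \<le> c i" and rt: "real r / real t = cf_value (map c [0..<Suc n])"
    using c by (auto simp: fin_cf_expansion_def)
  define p' q' where "p' = cf_num c n" and "q' = cf_den c n"
  have cop: "coprime (int r) (int t)"
  proof (rule coprimeI)
    fix d assume "d dvd int r" "d dvd int t"
    moreover from this have "d dvd int s" using t(2) by (meson dvd_trans int_dvd_int_iff)
    ultimately have "d dvd (-1) ^ Suc n" unfolding norm [symmetric] by (simp add: power2_eq_square)
    then show "is_unit d" by (rule dvd_unit_imp_unit) (simp add: is_unit_power_iff)
  qed
  have "cf_num c (Suc n) = int r \<and> cf_den c (Suc n) = int t"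
    using rt cf_value_conv [OF c1] t(1) cop cf_num_den_coprime [of c n] cf_den_bounds [OF c1]
    by (intro reduced_fraction_unique) auto
  then have p: "cf_num c (Suc n) = int r" and q: "cf_den c (Suc n) = int t" by auto
  \<comment> \<open>Both sides are \<open>(-1) ^ Suc n\<close>; this is where the prescribed parity
    of \<open>n\<close> enters.\<close>
  have det: "int r * q' - p' * int t = (int r)\<^sup>2 - int s * int N"
    using cf_det [of c n] norm by (simp add: p q p'_def q'_def)
  define R where "R = int r - c 0 * int t"
  have R_le: "0 \<le> R \<and> R \<le> int t"
  proof (cases n)
    case 0
    then show ?thesis using p q by (simp add: R_def)
  next
    case (Suc j)
    then show ?thesis using cf_num_remainder [of j c] c1 p q by (simp add: R_def)
  qed
  have q'_eq: "q' = R"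
  proof (cases n)
    \<comment> \<open>Here \<open>t = 1\<close> and \<open>c 0 = r\<close>, so both sides
      vanish.\<close>
    case 0
    then show ?thesis using p q by (simp add: R_def q'_def)
  next
    case (Suc j)
    have "1 \<le> q'" "q' \<le> int t"
      using cf_den_bounds [of j c] cf_den_bounds [OF c1] c1 q by (auto simp: q'_def Suc)
    moreover have "1 \<le> R" using cf_num_remainder [of j c] c1 p q by (simp add: R_def Suc)
    moreover have "int t dvd q' - R"
    proof -
      have "int r * (q' - R) = p' * int t - int s * int N + c 0 * int r * int t"
        using det by (simp add: R_def algebra_simps power2_eq_square)
      moreover have "int t dvd \<dots>" using t(2) by (intro dvd_add dvd_diff) auto
      ultimately show ?thesis
        using cop by (metis coprime_commute coprime_dvd_mult_right_iff)
    qed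
    ultimately show ?thesis
      using R_le dvd_imp_le_int [of "q' - R" "int t"] by (cases "q' = R") auto
  qed
  have ts: "int t \<le> int s" using t(2) s by (simp add: dvd_imp_le)
  have sN: "(int s)\<^sup>2 + int s \<le> int s * int N"
  proof -
    have "int s * (int s + 1) \<le> int s * int N" using N by (intro mult_left_mono) auto
    then show ?thesis by (simp add: algebra_simps power2_eq_square)
  qed
  have rs: "int s \<le> int r"
  proof -
    have "(-1 :: int) \<le> (-1) ^ Suc n" by (cases "even n") auto
    then have "(int s)\<^sup>2 \<le> (int r)\<^sup>2" using norm sN s by linarith
    then show ?thesis by (rule power2_le_imp_le) simp
  qed
  \<comment> \<open>Otherwise \<open>t \<le> s \<le> r \<le> R \<le> t\<close>, so all four are
    equal, and coprimality makes them 1. Then \<open>n \<le> 1\<close>: for \<open>n = 0\<close> the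
    remainder \<open>R\<close> would be 0, and for \<open>n = 1\<close> the norm equation would give
    \<open>N = 0\<close>.\<close>
  have c0: "1 \<le> c 0"
  proof (rule ccontr)
    assume "\<not> 1 \<le> c 0"
    then have "c 0 * int t \<le> 0" by (simp add: mult_nonpos_nonneg)
    then have eq: "int r = int s" "int t = int s" "R = int t"
      using R_le rs ts by (auto simp: R_def)
    then have "int t = 1" using cop by simp
    then have "n \<le> 1" using cf_den_ge [OF c1] q by simp
    then consider "n = 0" | "n = 1" by linarith
    then show False
    proof cases
      case 1
      then show False using p q eq(3) t(1) by (simp add: R_def)
    next
      case 2
      then show False using norm eq sN s by simp
    qed
  qed
  define x where "x = sqrt (real s * real N) / real t"
  have x0: "0 < x" using s N t(1) by (simp add: x_def)
  have y0: "0 < of_int (c 0) + x" using c0 x0 by (intro add_pos_pos) auto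
  have xx: "x * x * real t = of_int (c 0) * real r + of_int p'"
  proof -
    have "int s * int N = int t * (c 0 * int r + p')"
      using det by (simp add: q'_eq R_def algebra_simps power2_eq_square)
    then have "real_of_int (int s * int N) = real_of_int (int t * (c 0 * int r + p'))" by simp
    then have "real s * real N = real t * (of_int (c 0) * real r + of_int p')" by simp
    moreover have "x * x * real t * real t = real s * real N"
      using t(1) by (simp add: x_def)
    ultimately show ?thesis using t(1) by (simp add: mult.commute)
  qed
  have q'R: "real_of_int q' = real r - of_int (c 0) * real t" by (simp add: q'_eq R_def)
  \<comment> \<open>With \<open>q' = r - c 0 * t\<close> the unwanted linear terms in the
    fixed-point equation cancel, and what remains is \<open>xx\<close>.\<close>
  have "cf_ext (map c [0..<Suc n]) (of_int (c 0) + x) =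
      (real r * (of_int (c 0) + x) + of_int p') / (real t * (of_int (c 0) + x) + of_int q')"
    using cf_ext_conv [OF c1 y0] by (simp add: p q p'_def q'_def)
  also have "\<dots> = x"
  proof -
    have "0 < real t * (of_int (c 0) + x) + of_int q'"
      using cf_ext_den_pos [OF c1 y0] by (simp add: q q'_def)
    moreover have "real r * (of_int (c 0) + x) + of_int p'
        = x * (real t * (of_int (c 0) + x) + of_int q')"
      using xx by (simp add: q'R algebra_simps)
    ultimately show ?thesis by simp
  qed
  finally show ?thesis
    using c1 unfolding x_def [symmetric] by (intro cf_expansion_periodicI c0 x0) auto
qed

section \<open>The norm equation for both descriptions of a regular unit\<close>

text \<open>The fixed-point equation is quadratic in \<open>x\<close>. As \<open>x\<close> is
  irrational and \<open>x * x\<close> rational, its coefficients can be compared: one comparison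
  gives \<open>Q dvd s\<close>, and both together turn the determinant into the norm.\<close>

lemma norm_of_fixpoint:
  fixes D Q r s k :: nat and a :: "nat \<Rightarrow> int"
  defines "x \<equiv> sqrt (real D / real Q)"
  assumes "coprime D Q" "0 < D" "0 < Q" and irr: "x \<notin> \<rat>"
    and a: "\<forall>i\<in>{1..k}. 1 \<le> a i" and a0: "1 \<le> a 0"
    and r: "cf_num a (Suc k) = int r" and s: "cf_den a (Suc k) = int s"
    and fix_x: "cf_ext (map a [0..<Suc k]) (of_int (a 0) + x) = x"
  shows "Q dvd s" and "(real r)\<^sup>2 - (real s)\<^sup>2 * (real D / real Q) = (-1) ^ Suc k"
proof -
  define p' q' where "p' = cf_num a k" and "q' = cf_den a k"
  have x0: "0 < x" using assms by (simp add: x_def)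
  have xx: "x * x = real D / real Q" by (simp add: x_def)
  have y0: "0 < of_int (a 0) + x" using a0 x0 by (intro add_pos_pos) auto
  have "x = (real r * (of_int (a 0) + x) + of_int p') / (real s * (of_int (a 0) + x) + of_int q')"
    using cf_ext_conv [OF a y0] fix_x by (simp add: r s p'_def q'_def)
  then have "x * (real s * (of_int (a 0) + x) + of_int q') = real r * (of_int (a 0) + x) + of_int p'"
    using cf_ext_den_pos [OF a y0] by (simp add: s q'_def nonzero_eq_divide_eq)
  then have "real s * (x * x) + (real s * of_int (a 0) + of_int q') * x
      = (real r * of_int (a 0) + of_int p') + real r * x"
    by (simp add: algebra_simps)
  then have eqs: "real s * (real D / real Q) = real r * of_int (a 0) + of_int p' \<and>
      real s * of_int (a 0) + of_int q' = real r"
    unfolding xx using irr by (intro irrational_coeffs_eq [of x]) auto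
  then have "real s * real D = real Q * (real r * of_int (a 0) + of_int p')"
    using assms by (simp add: field_simps)
  then have "real_of_int (int s * int D) = real_of_int (int Q * (int r * a 0 + p'))" by simp
  then have "int s * int D = int Q * (int r * a 0 + p')" by (simp only: of_int_eq_iff)
  then have "int Q dvd int (s * D)" by simp
  then have "Q dvd s * D" by (simp only: int_dvd_int_iff)
  then show "Q dvd s" using assms(2) by (metis coprime_commute coprime_dvd_mult_left_iff)
  have "real_of_int (int r * q' - p' * int s) = real_of_int ((-1) ^ Suc k)"
    using cf_det [of a k] by (simp only: r s p'_def q'_def)
  then have det: "real r * of_int q' - of_int p' * real s = (-1) ^ Suc k" by simp
  have "(real r)\<^sup>2 - (real s)\<^sup>2 * (real D / real Q)
      = real r * (real r) - real s * (real s * (real D / real Q))"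
    by (simp add: power2_eq_square)
  also have "\<dots> = real r * (real s * of_int (a 0) + of_int q')
      - real s * (real r * of_int (a 0) + of_int p')"
    using eqs by simp
  also have "\<dots> = (-1) ^ Suc k" using det by (simp add: algebra_simps)
  finally show "(real r)\<^sup>2 - (real s)\<^sup>2 * (real D / real Q) = (-1) ^ Suc k" .
qed

text \<open>Since \<open>sqrt (D * Q) = Q * x\<close> and \<open>sqrt D1 = q * x\<close> for
  \<open>x = sqrt (D / Q)\<close>, membership in the smaller ring means that \<open>Q\<close>
  divides \<open>s\<close>, and invertibility in the larger one gives norm 1 or -1. The sign is left
  open.\<close>

lemma norm_of_regular_unit:
  fixes D Q r s :: nat
  assumes Q: "0 < Q" and irr: "sqrt (real D / real Q) \<notin> \<rat>"
    and unit: "regular_unit D Q (real r + real s * sqrt (real D / real Q))"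
  shows "Q dvd s" and "\<bar>(real r)\<^sup>2 - (real s)\<^sup>2 * (real D / real Q)\<bar> = 1"
proof -
  define x where "x = sqrt (real D / real Q)"
  define q where "q = (LEAST q. 0 < q \<and> q dvd Q \<and> Q dvd q ^ 2)"
  define D1 where "D1 = D * q ^ 2 div Q"
  have "0 < q \<and> q dvd Q \<and> Q dvd q ^ 2"
    unfolding q_def by (rule LeastI [of _ Q]) (use Q in \<open>auto simp: power2_eq_square\<close>)
  then have q: "0 < q" "Q dvd q ^ 2" by auto
  have u1: "unit_of (int_adjoin_sqrt D1) (real r + real s * x)"
    and u2: "real r + real s * x \<in> int_adjoin_sqrt (D * Q)"
    using unit by (auto simp: regular_unit_def Let_def q_def D1_def x_def)
  have xx: "x * x = real D / real Q" by (simp add: x_def)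
  have irr': "x \<notin> \<rat>" using irr by (simp add: x_def)
  \<comment> \<open>The division in \<open>D1\<close> is exact because \<open>Q\<close> divides the
    square of \<open>q\<close>.\<close>
  have D1: "real D1 = real D / real Q * (real q)\<^sup>2"
    using q(2) by (simp add: D1_def real_of_nat_div)
  then have s1: "sqrt (real D1) = real q * x" by (simp only: real_sqrt_mult x_def) simp
  have "real (D * Q) = real D / real Q * (real Q)\<^sup>2" using Q by (simp add: power2_eq_square)
  then have s2: "sqrt (real (D * Q)) = real Q * x" by (simp only: real_sqrt_mult x_def) simp
  obtain i j where "real r + real s * x = of_int i + of_int j * (real Q * x)"
    using u2 unfolding int_adjoin_sqrt_def s2 by auto
  then have "real r + real s * x = of_int i + (of_int j * real Q) * x" by simp
  then have "real s = of_int j * real Q"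
    using irrational_coeffs_eq [OF irr'] by (metis Rats_mult Rats_of_int Rats_of_nat)
  then have "real_of_int (int s) = real_of_int (j * int Q)" by simp
  then have "int s = j * int Q" by (simp only: of_int_eq_iff)
  then show "Q dvd s" by (metis dvd_triv_right int_dvd_int_iff)
  obtain i j i' j' where u: "real r + real s * x = of_int i + of_int j * (real q * x)"
    and uv: "(real r + real s * x) * (of_int i' + of_int j' * (real q * x)) = 1"
    using u1 unfolding unit_of_def int_adjoin_sqrt_def s1 by auto
  from u have "real r + real s * x = of_int i + (of_int j * real q) * x" by simp
  then have rs: "real r = of_int i" "real s = of_int j * real q"
    using irrational_coeffs_eq [OF irr'] by (metis Rats_mult Rats_of_int Rats_of_nat)+
  have D1x: "real D1 = real q * real q * (x * x)" by (simp add: D1 xx power2_eq_square)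
  have "of_int (i * i' + j * j' * int D1) + (of_int (i * j' + j * i') * real q) * x = 1 + 0 * x"
    using uv by (simp add: rs D1x algebra_simps)
  then have "real_of_int (i * i' + j * j' * int D1) = 1 \<and> of_int (i * j' + j * i') * real q = 0"
    by (intro irrational_coeffs_eq [OF irr']) auto
  then have "real_of_int (i * i' + j * j' * int D1) = of_int 1 \<and> real_of_int (i * j' + j * i') = of_int 0"
    using q(1) by simp
  then have e: "i * i' + j * j' * int D1 = 1" "i * j' + j * i' = 0"
    by (simp_all only: of_int_eq_iff)
  \<comment> \<open>Multiplicativity of the norm on the ring generated by \<open>sqrt D1\<close>,
    applied to the unit and its inverse.\<close>
  have "(i\<^sup>2 - j\<^sup>2 * int D1) * (i'\<^sup>2 - j'\<^sup>2 * int D1)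
      = (i * i' + j * j' * int D1)\<^sup>2 - int D1 * (i * j' + j * i')\<^sup>2"
    by (simp add: algebra_simps power2_eq_square)
  also have "\<dots> = 1" by (simp add: e)
  finally have "\<bar>i\<^sup>2 - j\<^sup>2 * int D1\<bar> = 1" by (auto simp: zmult_eq_1_iff)
  then have "\<bar>real_of_int (i\<^sup>2 - j\<^sup>2 * int D1)\<bar> = 1" by (metis of_int_1 of_int_abs)
  then show "\<bar>(real r)\<^sup>2 - (real s)\<^sup>2 * (real D / real Q)\<bar> = 1"
    by (simp add: rs D1 power_mult_distrib mult_ac)
qed

theorem theorem3:
  fixes D Q m k t n :: nat
    and b c :: "nat \<Rightarrow> int"
    and r s :: "nat \<Rightarrow> nat"
  assumes "0 < D" and "0 < Q" and "coprime D Q"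
    and "real D / real Q > 1"
    and "\<not> (\<exists>x\<in>\<rat>. real D / real Q = x ^ 2)"
    and "sqrt_type_expansion (sqrt (real D / real Q)) b m"
    and "\<And>b' m'. sqrt_type_expansion (sqrt (real D / real Q)) b' m' \<Longrightarrow> m \<le> m'"
    and "\<And>j. 0 < r j \<and> 0 < s j \<and> coprime (r j) (s j)"
    and "\<And>j. real (r j) / real (s j) = cf_value (map (periodic_terms b m) [0..<Suc j])"
    and "regular_unit D Q (real (r k) + real (s k) * sqrt (real D / real Q))
         \<or> (\<exists>l\<ge>1. k = l * (m + 1) - 1)"
    and "0 < t" and "t dvd s k"
    and "fin_cf_expansion (real (r k) / real t) c n" and "n mod 2 = k mod 2"
  shows "cf_expansion (real (s k) / real t * sqrt (real D / real Q)) (periodic_terms c n)"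
proof -
  note Dpos = assms(1) and Qpos = assms(2) and cop = assms(3)
    and b_exp = assms(6) and rs_pos = assms(8) and conv = assms(9) and regular = assms(10)
  define x where "x = sqrt (real D / real Q)"
  define a where "a = periodic_terms b m"
  have x0: "0 < x" using Dpos Qpos by (simp add: x_def)
  have xx: "x\<^sup>2 = real D / real Q" by (simp add: x_def)
  have irr: "x \<notin> \<rat>" using assms(5) xx by metis
  have exp_a: "cf_expansion x a" and b0: "1 \<le> b 0"
    using b_exp by (auto simp: sqrt_type_expansion_def a_def x_def)
  have a1: "\<forall>i\<in>{1..k}. 1 \<le> a i" using exp_a by (auto simp: cf_expansion_def)
  have pos: "0 < r k" "0 < s k" using rs_pos by auto
  have conv_k: "real (r k) / real (s k) = cf_value (map a [0..<Suc k])"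
    using conv by (simp add: a_def)
  have "cf_num a (Suc k) = int (r k) \<and> cf_den a (Suc k) = int (s k)"
    using conv_k cf_value_conv [OF a1] rs_pos cf_num_den_coprime [of a k] cf_den_bounds [OF a1]
    by (intro reduced_fraction_unique) auto
  then have p: "cf_num a (Suc k) = int (r k)" and q: "cf_den a (Suc k) = int (s k)" by auto
  have "Q dvd s k \<and> (real (r k))\<^sup>2 - (real (s k))\<^sup>2 * (real D / real Q) = (-1) ^ Suc k"
    using regular
  proof
    assume unit: "regular_unit D Q (real (r k) + real (s k) * sqrt (real D / real Q))"
    define \<nu> where "\<nu> = (real (r k))\<^sup>2 - (real (s k))\<^sup>2 * (real D / real Q)"
    have Qs: "Q dvd s k" and \<nu>1: "\<bar>\<nu>\<bar> = 1"
      using norm_of_regular_unit [OF Qpos _ unit] irr by (auto simp: \<nu>_def x_def)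
    have \<nu>: "\<nu> = (real (r k) - real (s k) * x) * (real (r k) + real (s k) * x)"
      by (simp add: \<nu>_def algebra_simps power2_eq_square flip: xx)
    \<comment> \<open>The position of the \<open>k\<close>-th convergent relative to
      \<open>x\<close> determines the sign of the norm, whose absolute value is already known to be
      1.\<close>
    have "0 \<le> real (s k) * ((-1) ^ k * (x - real (r k) / real (s k)))"
      using cf_expansion_sign [OF exp_a, of k] pos by (simp only: conv_k mult_nonneg_nonneg of_nat_0_le_iff)
    also have "\<dots> = (-1) ^ Suc k * (real (r k) - real (s k) * x)"
      using pos by (simp add: algebra_simps)
    finally have "0 \<le> (-1) ^ Suc k * (real (r k) - real (s k) * x) * (real (r k) + real (s k) * x)"
      by (rule mult_nonneg_nonneg) (use x0 in simp)
    then have "0 \<le> (-1) ^ Suc k * \<nu>" unfolding \<nu> mult.assoc .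
    then have "\<nu> = (-1) ^ Suc k" using \<nu>1 by (cases "even k") auto
    then show ?thesis using Qs by (simp add: \<nu>_def)
  next
    assume "\<exists>l\<ge>1. k = l * (m + 1) - 1"
    then obtain l where l: "1 \<le> l" "k = l * (m + 1) - 1" by blast
    \<comment> \<open>Positivity keeps the natural-number subtraction in
      \<open>k = l * (m + 1) - 1\<close> from truncating.\<close>
    then have "0 < l * Suc m" by simp
    then have "Suc k = l * Suc m" using l(2) by simp
    then have "cf_ext (map a [0..<Suc k]) (of_int (a 0) + x) = x"
      using sqrt_type_expansion_fixpoint [OF b_exp _ l(1)] x0 by (simp add: a_def x_def)
    then show ?thesis
      using norm_of_fixpoint [OF cop Dpos Qpos, of k a "r k" "s k"] irr a1 b0 p q
      by (simp add: x_def a_def)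
  qed
  then obtain e where e: "s k = Q * e"
    and norm: "(real (r k))\<^sup>2 - (real (s k))\<^sup>2 * (real D / real Q) = (-1) ^ Suc k"
    unfolding dvd_def by blast
  \<comment> \<open>\<open>D * e\<close>, that is \<open>s k * D / Q\<close>, takes the role of
    \<open>N\<close> in \<open>cf_expansion_of_norm\<close>; it exceeds \<open>s k = Q * e\<close>
    because \<open>Q < D\<close>.\<close>
  have sN: "(real (s k))\<^sup>2 * (real D / real Q) = real (s k) * real (D * e)"
    using Qpos by (simp add: e power2_eq_square)
  have "(-1 :: real) ^ Suc k = (-1) ^ Suc n"
    using assms(14) by (cases "even k") (auto simp: even_iff_mod_2_eq_zero)
  then have "real_of_int ((int (r k))\<^sup>2 - int (s k) * int (D * e)) = real_of_int ((-1) ^ Suc n)"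
    using norm sN by simp
  then have norm': "(int (r k))\<^sup>2 - int (s k) * int (D * e) = (-1) ^ Suc n"
    by (simp only: of_int_eq_iff)
  have "Q < D" using assms(4) Qpos by simp
  then have "s k < D * e" using pos by (simp add: e)
  then have "cf_expansion (sqrt (real (s k) * real (D * e)) / real t) (periodic_terms c n)"
    using cf_expansion_of_norm [OF norm'] pos assms(11-13) by blast
  moreover have "sqrt (real (s k) * real (D * e)) = real (s k) * sqrt (real D / real Q)"
    unfolding sN [symmetric] real_sqrt_mult by simp
  ultimately show ?thesis by simp
qed

end
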